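(* Let $k$ be an even integer greater than $2$ and $n$ an odd integer greater than $k$. Let $G=(\mathbb{Z}_n;\{1,2,\dots,k-1\})$ be the hypergraph with vertex set $\mathbb{Z}_n$ and edges $\{i,i+1,\dots,i+k-1\}$ (indices mod $n$) for $i\in\mathbb{Z}_n$. Then $G$ is minimal non-odd-bipartite if and only if $\gcd(k,n)=1$.
   Context: For $k$ even, a $k$-uniform hypergraph $G$ (every edge has $k$ vertices, no multiple edges) is odd-bipartite if there is a bipartition $\{U,U^c\}$ of $V(G)$ such that every edge meets $U$ (and hence $U^c$) in an odd number of vertices. It is minimal non-odd-bipartite if it is not odd-bipartite but $G-e$ (delete the edge $e$ from the edge set) is odd-bipartite for every edge $e$. *)

theory Defs
  imports Main
begin

record 'a hypergraph =
  verts :: "'a set"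
  edges :: "'a set set"

definition uniform_hypergraph :: "nat \<Rightarrow> 'a hypergraph \<Rightarrow> bool" where
  "uniform_hypergraph k G \<longleftrightarrow>
     finite (verts G) \<and> (\<forall>e \<in> edges G. e \<subseteq> verts G \<and> card e = k)"

text \<open>Meaningful for uniform hypergraphs of even rank. There an edge that meets \<open>U\<close> in an odd
  number of vertices also meets the complement of \<open>U\<close> in an odd number of vertices, so both parts
  are automatically nonempty as soon as there is an edge.\<close>

definition odd_bipartite :: "'a hypergraph \<Rightarrow> bool" where
  "odd_bipartite G \<longleftrightarrow> (\<exists>U \<subseteq> verts G. \<forall>e \<in> edges G. odd (card (e \<inter> U)))"

definition delete_edge :: "'a hypergraph \<Rightarrow> 'a set \<Rightarrow> 'a hypergraph" where
  "delete_edge G e = G\<lparr>edges := edges G - {e}\<rparr>"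

definition minimal_non_odd_bipartite :: "'a hypergraph \<Rightarrow> bool" where
  "minimal_non_odd_bipartite G \<longleftrightarrow>
     \<not> odd_bipartite G \<and> (\<forall>e \<in> edges G. odd_bipartite (delete_edge G e))"

text \<open>The residues modulo \<open>n\<close> are represented by \<open>0, \<dots>, n - 1\<close>; the edges are the sets
  of \<open>k\<close> cyclically consecutive residues.\<close>

definition cyclic_hypergraph :: "nat \<Rightarrow> nat \<Rightarrow> nat hypergraph" where
  "cyclic_hypergraph n k =
     \<lparr>verts = {0..<n}, edges = {(\<lambda>j. (i + j) mod n) ` {0..k - 1} | i. i \<in> {0..<n}}\<rparr>"

lemma uniform_cyclic_hypergraph:
  assumes "0 < k" and "k \<le> n"
  shows "uniform_hypergraph k (cyclic_hypergraph n k)"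
proof -
  have "inj_on (\<lambda>j. (i + j) mod n) {0..k - 1}" for i
  proof (rule linorder_inj_onI')
    fix a b assume ab: "a \<in> {0..k - 1}" "b \<in> {0..k - 1}" "a < b"
    show "(i + a) mod n \<noteq> (i + b) mod n"
    proof
      assume "(i + a) mod n = (i + b) mod n"
      then have "n dvd (i + b) - (i + a)"
        using ab by (metis mod_eq_dvd_iff_nat add_le_cancel_left less_imp_le)
      then have "n \<le> b - a" using ab by (auto dest: dvd_imp_le)
      then show False using ab assms by auto
    qed
  qed
  then show ?thesis
    using assms by (auto simp: uniform_hypergraph_def cyclic_hypergraph_def card_image)
qed

end

theory Submission
  imports Defs "HOL-Number_Theory.Cong"
begin

text \<open>Let \<open>d\<close> be a common divisor of \<open>k\<close> and \<open>n\<close>. Among the edges whose first vertex lies in a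
  fixed residue class modulo \<open>d\<close>, each vertex has degree \<open>k / d\<close>, which is even, while the number
  \<open>n / d\<close> of these edges is odd. By double counting they cannot all meet \<open>U\<close> in an odd number of
  vertices. With \<open>d = 1\<close> this shows that the hypergraph is never odd-bipartite; with
  \<open>d = gcd k n > 1\<close> the obstruction survives the deletion of an edge from another residue class.

  If \<open>gcd k n = 1\<close>, write \<open>n l = m k + 1\<close>, so that \<open>l\<close> is odd, and let
  \<open>U = {s + k, s + 2k, \<dots>, s + m k}\<close>. The edge starting at \<open>i\<close> contains \<open>s + (t + 1) k\<close> if and only
  if \<open>i\<close> has a representative among the \<open>k\<close> integers following \<open>s + t k\<close>. For \<open>t < m\<close> these blocks
  tile \<open>s + 1, \<dots>, s + m k = s + n l - 1\<close>, which contains \<open>l\<close> representatives of each residue other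
  than \<open>s\<close>. So every edge except the one starting at \<open>s\<close> meets \<open>U\<close> in exactly \<open>l\<close> vertices.\<close>

definition degree :: "'a set set \<Rightarrow> 'a \<Rightarrow> nat" where
  "degree F v = card {e \<in> F. v \<in> e}"

lemma sum_card_Int_eq_sum_degree:
  assumes "finite F" "finite U"
  shows "(\<Sum>e\<in>F. card (e \<inter> U)) = (\<Sum>v\<in>U. degree F v)"
proof -
  have "(\<Sum>e\<in>F. card {v \<in> U. v \<in> e}) = (\<Sum>v\<in>U. degree F v)"
    using assms by (intro sum_multicount_gen) (auto simp: degree_def)
  then show ?thesis by (simp add: Int_def conj_commute)
qed

lemma not_odd_bipartite_if_even_degrees:
  assumes "finite (verts G)" "F \<subseteq> edges G" "odd (card F)"
    and even_degree: "\<And>v. v \<in> verts G \<Longrightarrow> even (degree F v)"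
  shows "\<not> odd_bipartite G"
proof
  assume "odd_bipartite G"
  then obtain U where "U \<subseteq> verts G" and odd_Int: "\<And>e. e \<in> F \<Longrightarrow> odd (card (e \<inter> U))"
    using \<open>F \<subseteq> edges G\<close> unfolding odd_bipartite_def by blast
  have "finite F" using \<open>odd (card F)\<close> by (auto intro: card_ge_0_finite odd_pos)
  have "finite U" using \<open>U \<subseteq> verts G\<close> \<open>finite (verts G)\<close> by (rule finite_subset)
  have "even (\<Sum>v\<in>U. degree F v)"
    using even_degree \<open>U \<subseteq> verts G\<close> by (blast intro: dvd_sum)
  then have "even (\<Sum>e\<in>F. card (e \<inter> U))"
    using sum_card_Int_eq_sum_degree \<open>finite F\<close> \<open>finite U\<close> by metis
  moreover have "{e \<in> F. odd (card (e \<inter> U))} = F" using odd_Int by blast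
  ultimately show False using \<open>odd (card F)\<close> by (simp add: even_sum_iff \<open>finite F\<close>)
qed

lemma edges_delete_edge [simp]: "edges (delete_edge G e) = edges G - {e}"
  and verts_delete_edge [simp]: "verts (delete_edge G e) = verts G"
  by (simp_all add: delete_edge_def)

lemma card_lessThan_mult_cong:
  fixes c d q r :: nat
  assumes "0 < d"
  shows "card {j \<in> {..<q * d}. [c + j = r] (mod d)} = q"
proof -
  define r' where "r' = (r + (d - 1) * c) mod d"
  have "c + (r + (d - 1) * c) = r + d * c"
    using assms by (cases d) simp_all
  then have "(c + (r + (d - 1) * c)) mod d = r mod d" by (simp only: mod_mult_self2)
  then have "[c + r' = r] (mod d)" by (simp only: r'_def cong_def mod_add_right_eq)
  then have "[c + j = r] (mod d) \<longleftrightarrow> [c + j = c + r'] (mod d)" for j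
    by (metis cong_sym cong_trans)
  then have cong_iff: "[c + j = r] (mod d) \<longleftrightarrow> j mod d = r'" for j
    by (simp add: cong_add_lcancel_nat) (simp add: cong_def r'_def)
  have "r' < d" using assms by (simp add: r'_def)
  have "{j \<in> {..<q * d}. [c + j = r] (mod d)} = (\<lambda>a. a * d + r') ` {..<q}"
  proof (intro subset_antisym subsetI)
    fix j assume "j \<in> {j \<in> {..<q * d}. [c + j = r] (mod d)}"
    then have "j div d < q" "j = j div d * d + r'"
      using div_mult_mod_eq[of j d] by (auto simp: cong_iff less_mult_imp_div_less)
    then show "j \<in> (\<lambda>a. a * d + r') ` {..<q}" by blast
  next
    fix j assume "j \<in> (\<lambda>a. a * d + r') ` {..<q}"
    then obtain a where "a < q" "j = a * d + r'" by blast
    moreover have "Suc a * d \<le> q * d" using \<open>a < q\<close> by (intro mult_le_mono1) simp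
    ultimately show "j \<in> {j \<in> {..<q * d}. [c + j = r] (mod d)}"
      using \<open>r' < d\<close> by (simp add: cong_iff)
  qed
  moreover have "inj_on (\<lambda>a. a * d + r') {..<q}" using assms by (simp add: inj_on_def)
  ultimately show ?thesis by (simp add: card_image)
qed

definition cyclic_edge :: "nat \<Rightarrow> nat \<Rightarrow> nat \<Rightarrow> nat set" where
  "cyclic_edge n k i = (\<lambda>j. (i + j) mod n) ` {..<k}"

lemma verts_cyclic_hypergraph [simp]: "verts (cyclic_hypergraph n k) = {..<n}"
  by (auto simp: cyclic_hypergraph_def)

lemma edges_cyclic_hypergraph:
  assumes "0 < k"
  shows "edges (cyclic_hypergraph n k) = cyclic_edge n k ` {..<n}"
proof -
  have "{0..k - 1} = {..<k}" using assms by auto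
  then show ?thesis by (auto simp: cyclic_hypergraph_def cyclic_edge_def)
qed

lemma mem_cyclic_edge_iff:
  assumes "v < n"
  shows "v \<in> cyclic_edge n k i \<longleftrightarrow> (\<exists>j<k. [i + j = v] (mod n))"
  using assms by (auto simp: cyclic_edge_def cong_def)

lemma inj_on_add_mod:
  fixes i k n :: nat
  assumes "k \<le> n"
  shows "inj_on (\<lambda>j. (i + j) mod n) {..<k}"
proof (rule inj_onI)
  fix a b assume "a \<in> {..<k}" "b \<in> {..<k}" "(i + a) mod n = (i + b) mod n"
  then have "[a = b] (mod n)" "a < n" "b < n"
    using assms by (auto simp: cong_def[symmetric] cong_add_lcancel_nat)
  then show "a = b" by (rule cong_less_modulus_unique_nat)
qed

text \<open>The first vertex of an edge is its only element whose cyclic predecessor lies outside it.\<close>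

lemma inj_on_cyclic_edge:
  assumes "k < n" "0 < k"
  shows "inj_on (cyclic_edge n k) {..<n}"
proof (rule inj_onI, rule ccontr)
  fix a b
  assume ab: "a \<in> {..<n}" "b \<in> {..<n}" "a \<noteq> b" and eq: "cyclic_edge n k a = cyclic_edge n k b"
  have "[a + 0 = a] (mod n)" by simp
  then have "a \<in> cyclic_edge n k b"
    using ab \<open>0 < k\<close> unfolding eq[symmetric] by (auto simp: mem_cyclic_edge_iff)
  then obtain j where "j < k" and j: "[b + j = a] (mod n)"
    using ab by (auto simp: mem_cyclic_edge_iff)
  have "j \<noteq> 0" using j ab by (auto dest: cong_less_modulus_unique_nat)
  then obtain j' where "j = Suc j'" by (cases j) auto
  then have "(b + j') mod n \<in> cyclic_edge n k a"
    using \<open>j < k\<close> unfolding eq by (auto simp: cyclic_edge_def)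
  then obtain i where "i < k" and i: "[b + j' = a + i] (mod n)"
    by (auto simp: cyclic_edge_def cong_def)
  have "[a + Suc i = b + j' + 1] (mod n)"
    using cong_add[OF cong_sym[OF i] cong_refl[of 1]] by simp
  also have "[b + j' + 1 = a] (mod n)" using j \<open>j = Suc j'\<close> by simp
  finally have "n dvd Suc i" by (simp only: cong_add_lcancel_0_nat cong_0_iff)
  then show False using \<open>i < k\<close> \<open>k < n\<close> by (auto dest: dvd_imp_le)
qed

lemma add_mod_mem_cyclic_edge_iff:
  assumes "i < n"
  shows "(c + k) mod n \<in> cyclic_edge n k i \<longleftrightarrow> i \<in> cyclic_edge n k (Suc c)"
proof -
  have reflect: "[i + j = c + k] (mod n) \<longleftrightarrow> [Suc c + j' = i] (mod n)"
    if "Suc (j + j') = k" for j j'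
  proof -
    have "c + k = Suc c + j' + j" using that by simp
    then have "[i + j = c + k] (mod n) \<longleftrightarrow> [i = Suc c + j'] (mod n)"
      by (simp only: cong_add_rcancel_nat)
    then show ?thesis by (simp add: cong_sym_eq)
  qed
  have "(c + k) mod n \<in> cyclic_edge n k i \<longleftrightarrow> (\<exists>j<k. [i + j = c + k] (mod n))"
    using assms by (simp add: mem_cyclic_edge_iff)
  also have "\<dots> \<longleftrightarrow> (\<exists>j<k. [Suc c + j = i] (mod n))"
  proof
    assume "\<exists>j<k. [i + j = c + k] (mod n)"
    then obtain j where "j < k" "[i + j = c + k] (mod n)" by blast
    then show "\<exists>j<k. [Suc c + j = i] (mod n)"
      using reflect[of j "k - Suc j"] by (intro exI[of _ "k - Suc j"]) simp
  next
    assume "\<exists>j<k. [Suc c + j = i] (mod n)"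
    then obtain j where "j < k" "[Suc c + j = i] (mod n)" by blast
    then show "\<exists>j<k. [i + j = c + k] (mod n)"
      using reflect[of "k - Suc j" j] by (intro exI[of _ "k - Suc j"]) simp
  qed
  also have "\<dots> \<longleftrightarrow> i \<in> cyclic_edge n k (Suc c)"
    using assms by (simp add: mem_cyclic_edge_iff)
  finally show ?thesis .
qed

definition residue_edges :: "nat \<Rightarrow> nat \<Rightarrow> nat \<Rightarrow> nat \<Rightarrow> nat set set" where
  "residue_edges n k d r = cyclic_edge n k ` {i \<in> {..<n}. [i = r] (mod d)}"

lemma card_residue_edges:
  assumes "k < n" "0 < k" "d dvd n"
  shows "card (residue_edges n k d r) = n div d"
proof -
  have "0 < d" using assms by (intro dvd_pos_nat[of n d]) simp_all
  have "inj_on (cyclic_edge n k) {i \<in> {..<n}. [i = r] (mod d)}"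
    by (rule inj_on_subset[OF inj_on_cyclic_edge[OF \<open>k < n\<close> \<open>0 < k\<close>]]) auto
  then have "card (residue_edges n k d r) = card {i \<in> {..<n}. [i = r] (mod d)}"
    by (simp add: residue_edges_def card_image)
  also have "\<dots> = n div d"
    using card_lessThan_mult_cong[of d "n div d" 0 r] \<open>0 < d\<close> \<open>d dvd n\<close> by simp
  finally show ?thesis .
qed

lemma degree_residue_edges:
  assumes "k < n" "0 < k" "d dvd n" "d dvd k" "v < n"
  shows "degree (residue_edges n k d r) v = k div d"
proof -
  define c where "c = v + (n - k)"
  define J where "J = {j \<in> {..<k}. [Suc c + j = r] (mod d)}"
  have "0 < d" using assms by (intro dvd_pos_nat[of n d]) simp_all
  have "(c + k) mod n = v" using assms by (simp add: c_def)
  then have starts_iff: "v \<in> cyclic_edge n k i \<longleftrightarrow> i \<in> cyclic_edge n k (Suc c)" if "i < n" for i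
    using add_mod_mem_cyclic_edge_iff[OF that, of c k] by simp
  have mod_cong_iff: "[x mod n = r] (mod d) \<longleftrightarrow> [x = r] (mod d)" for x
    using \<open>d dvd n\<close> by (simp add: cong_def mod_mod_cancel)
  have "degree (residue_edges n k d r) v =
      card (cyclic_edge n k ` {i \<in> {..<n}. [i = r] (mod d) \<and> v \<in> cyclic_edge n k i})"
    unfolding degree_def residue_edges_def by (intro arg_cong[of _ _ card]) auto
  also have "\<dots> = card {i \<in> {..<n}. [i = r] (mod d) \<and> v \<in> cyclic_edge n k i}"
    by (intro card_image inj_on_subset[OF inj_on_cyclic_edge[OF \<open>k < n\<close> \<open>0 < k\<close>]]) auto
  also have "{i \<in> {..<n}. [i = r] (mod d) \<and> v \<in> cyclic_edge n k i} =
      {i \<in> {..<n}. [i = r] (mod d) \<and> i \<in> cyclic_edge n k (Suc c)}"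
    using starts_iff by blast
  also have "\<dots> = (\<lambda>j. (Suc c + j) mod n) ` J"
    using \<open>v < n\<close> mod_cong_iff by (auto simp: J_def cyclic_edge_def)
  also have "card \<dots> = card J"
    using \<open>k < n\<close> unfolding J_def
    by (intro card_image inj_on_subset[OF inj_on_add_mod[of k n]]) auto
  also have "\<dots> = k div d"
    using card_lessThan_mult_cong[of d "k div d" "Suc c" r] \<open>0 < d\<close> \<open>d dvd k\<close> by (simp add: J_def)
  finally show ?thesis .
qed

lemma not_odd_bipartite_if_residue_edges_subset:
  assumes "even k" "0 < k" "odd n" "k < n" "d dvd k" "d dvd n"
    and "verts G = {..<n}" "residue_edges n k d r \<subseteq> edges G"
  shows "\<not> odd_bipartite G"
proof (rule not_odd_bipartite_if_even_degrees)
  have "odd (n div d * d)" and "even (k div d * d)" using assms by simp_all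
  then have "odd (n div d)" and "even (k div d)" by auto
  then show "odd (card (residue_edges n k d r))"
    using assms by (simp add: card_residue_edges)
  show "even (degree (residue_edges n k d r) v)" if "v \<in> verts G" for v
    using assms that \<open>even (k div d)\<close> by (simp add: degree_residue_edges)
qed (use assms in simp_all)

lemma not_odd_bipartite_cyclic_hypergraph:
  assumes "even k" "0 < k" "odd n" "k < n"
  shows "\<not> odd_bipartite (cyclic_hypergraph n k)"
  using assms
  by (intro not_odd_bipartite_if_residue_edges_subset[where d = 1])
    (auto simp: residue_edges_def edges_cyclic_hypergraph)

lemma not_odd_bipartite_delete_cyclic_edge:
  assumes "even k" "0 < k" "odd n" "k < n" "\<not> coprime k n" "s < n"
  shows "\<not> odd_bipartite (delete_edge (cyclic_hypergraph n k) (cyclic_edge n k s))"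
proof -
  have "[s + 1 = s] (mod gcd k n) \<longleftrightarrow> gcd k n dvd 1"
    by (simp only: cong_add_lcancel_0_nat cong_0_iff)
  then have "\<not> [s = Suc s] (mod gcd k n)"
    using \<open>\<not> coprime k n\<close> by (auto simp: coprime_iff_gcd_eq_1 dest: cong_sym)
  then have "cyclic_edge n k s \<notin> residue_edges n k (gcd k n) (Suc s)"
    using inj_on_cyclic_edge[OF \<open>k < n\<close> \<open>0 < k\<close>] \<open>s < n\<close>
    by (auto simp: residue_edges_def dest: inj_onD)
  then have "residue_edges n k (gcd k n) (Suc s)
      \<subseteq> edges (delete_edge (cyclic_hypergraph n k) (cyclic_edge n k s))"
    using \<open>0 < k\<close> by (auto simp: residue_edges_def edges_cyclic_hypergraph)
  then show ?thesis
    using assms by (intro not_odd_bipartite_if_residue_edges_subset[where d = "gcd k n"]) simp_all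
qed

lemma of_bool_mem_cyclic_edge:
  assumes "k \<le> n" "v < n"
  shows "of_bool (v \<in> cyclic_edge n k i) = card {j \<in> {..<k}. [i + j = v] (mod n)}"
proof (cases "v \<in> cyclic_edge n k i")
  case True
  then obtain j where "j < k" and j: "[i + j = v] (mod n)"
    using \<open>v < n\<close> by (auto simp: mem_cyclic_edge_iff)
  have "j' = j" if "j' < k" "[i + j' = v] (mod n)" for j'
  proof (rule inj_onD[OF inj_on_add_mod[OF \<open>k \<le> n\<close>]])
    show "(i + j') mod n = (i + j) mod n" using that(2) j by (simp add: cong_def)
  qed (use \<open>j < k\<close> that in simp_all)
  then have "{j \<in> {..<k}. [i + j = v] (mod n)} = {j}" using \<open>j < k\<close> j by blast
  then show ?thesis using True by simp
next
  case False
  then have "{j \<in> {..<k}. [i + j = v] (mod n)} = {}"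
    using \<open>v < n\<close> by (auto simp: mem_cyclic_edge_iff)
  with False show ?thesis by (simp only: of_bool_eq card.empty)
qed

lemma card_consecutive_cyclic_edges_containing:
  assumes "k \<le> n" "v < n"
  shows "card {t \<in> {..<m}. v \<in> cyclic_edge n k (i + t * k)}
    = card {x \<in> {..<m * k}. [i + x = v] (mod n)}"
proof -
  let ?hit = "\<lambda>x. of_bool ([i + x = v] (mod n)) :: nat"
  have block: "of_bool (v \<in> cyclic_edge n k (i + t * k)) = sum ?hit {t * k..<t * k + k}" for t
  proof -
    have "of_bool (v \<in> cyclic_edge n k (i + t * k)) = (\<Sum>j<k. ?hit (j + t * k))"
      using of_bool_mem_cyclic_edge[OF assms] by (simp add: Int_def ac_simps)
    also have "\<dots> = sum ?hit {t * k..<t * k + k}"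
      using sum.shift_bounds_nat_ivl[of ?hit 0 "t * k" k]
      by (simp add: atLeast0LessThan add.commute)
    finally show ?thesis .
  qed
  have "card {t \<in> {..<m}. v \<in> cyclic_edge n k (i + t * k)}
      = (\<Sum>t<m. of_bool (v \<in> cyclic_edge n k (i + t * k)))"
    by (simp add: Int_def)
  also have "\<dots> = sum ?hit {..<m * k}"
    by (simp only: block sum.nat_group)
  also have "\<dots> = card {x \<in> {..<m * k}. [i + x = v] (mod n)}"
    by (simp add: Int_def)
  finally show ?thesis .
qed

definition progression :: "nat \<Rightarrow> nat \<Rightarrow> nat \<Rightarrow> nat \<Rightarrow> nat set" where
  "progression n k s m = (\<lambda>t. (s + t * k + k) mod n) ` {..<m}"

lemma inj_on_progression:
  fixes k m n s :: nat
  assumes "coprime k n" "m \<le> n"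
  shows "inj_on (\<lambda>t. (s + t * k + k) mod n) {..<m}"
proof (rule inj_onI)
  fix t u assume "t \<in> {..<m}" "u \<in> {..<m}" "(s + t * k + k) mod n = (s + u * k + k) mod n"
  then have "[t * k = u * k] (mod n)"
    by (simp only: cong_def[symmetric] cong_add_lcancel_nat cong_add_rcancel_nat)
  then have "[t = u] (mod n)" using \<open>coprime k n\<close> by (simp only: cong_mult_rcancel_nat)
  moreover have "t < n" "u < n"
    using \<open>t \<in> {..<m}\<close> \<open>u \<in> {..<m}\<close> \<open>m \<le> n\<close> by simp_all
  ultimately show "t = u" by (rule cong_less_modulus_unique_nat)
qed

lemma coprime_if_mult_eq_mult_add_1:
  fixes k l m n :: nat
  assumes "n * l = m * k + 1"
  shows "coprime k n"
proof (rule coprimeI)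
  fix c assume "c dvd k" "c dvd n"
  then have "c dvd m * k" "c dvd n * l" by simp_all
  then show "is_unit c" unfolding assms by (simp only: dvd_add_right_iff)
qed

lemma card_cyclic_edge_Int_progression:
  assumes bezout: "n * l = m * k + 1" and "k \<le> n" "m \<le> n" "i < n" "s < n" "i \<noteq> s"
  shows "card (cyclic_edge n k i \<inter> progression n k s m) = l"
proof -
  let ?f = "\<lambda>t. (s + t * k + k) mod n"
  have "coprime k n" using bezout by (rule coprime_if_mult_eq_mult_add_1)
  have inj_on_hits: "inj_on ?f {t \<in> {..<m}. ?f t \<in> cyclic_edge n k i}"
    by (rule inj_on_subset[OF inj_on_progression[OF \<open>coprime k n\<close> \<open>m \<le> n\<close>]]) blast
  have starts_iff: "?f t \<in> cyclic_edge n k i \<longleftrightarrow> i \<in> cyclic_edge n k (Suc s + t * k)" for t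
    using add_mod_mem_cyclic_edge_iff[OF \<open>i < n\<close>, of "s + t * k" k] by (simp only: add_Suc)
  have "cyclic_edge n k i \<inter> progression n k s m = ?f ` {t \<in> {..<m}. ?f t \<in> cyclic_edge n k i}"
    by (auto simp: progression_def)
  then have "card (cyclic_edge n k i \<inter> progression n k s m) =
      card {t \<in> {..<m}. ?f t \<in> cyclic_edge n k i}"
    by (simp only: card_image[OF inj_on_hits])
  also have "\<dots> = card {t \<in> {..<m}. i \<in> cyclic_edge n k (Suc s + t * k)}"
    by (simp only: starts_iff)
  also have "\<dots> = card {x \<in> {..<m * k}. [Suc s + x = i] (mod n)}"
    by (rule card_consecutive_cyclic_edges_containing[OF \<open>k \<le> n\<close> \<open>i < n\<close>])
  also have "{x \<in> {..<m * k}. [Suc s + x = i] (mod n)} =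
      {x \<in> {..<l * n}. [Suc s + x = i] (mod n)}"
  proof -
    have "Suc s + m * k = s + n * l" using bezout by simp
    then have "(Suc s + m * k) mod n = s" using \<open>s < n\<close> by (simp only: mod_mult_self2 mod_less)
    then have "\<not> [Suc s + m * k = i] (mod n)" using \<open>i < n\<close> \<open>i \<noteq> s\<close> by (simp add: cong_def)
    moreover have "x < l * n \<longleftrightarrow> x < m * k \<or> x = m * k" for x
      using bezout by (auto simp: mult.commute[of l n])
    ultimately show ?thesis by auto
  qed
  also have "card \<dots> = l" using \<open>i < n\<close> by (intro card_lessThan_mult_cong) simp
  finally show ?thesis .
qed

lemma bezout_bounded:
  fixes k n :: nat
  assumes "coprime k n" "1 < k"
  obtains l m where "n * l = m * k + 1" "m \<le> n"
proof -
  obtain l where "l < k" "[n * l = 1] (mod k)"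
    using assms coprime_iff_invertible'_nat[of k n] by (auto simp: coprime_commute)
  then have "n * l = n * l div k * k + 1"
    using div_mult_mod_eq[of "n * l" k] \<open>1 < k\<close> by (simp add: cong_def)
  moreover have "n * l div k \<le> n"
  proof -
    have "n * l \<le> n * k" using \<open>l < k\<close> by simp
    then show ?thesis using div_le_mono[of "n * l" "n * k" k] \<open>1 < k\<close> by simp
  qed
  ultimately show thesis by (rule that)
qed

lemma odd_bipartite_delete_cyclic_edge:
  assumes "even k" "0 < k" "k < n" "coprime k n" "s < n"
  shows "odd_bipartite (delete_edge (cyclic_hypergraph n k) (cyclic_edge n k s))"
proof -
  have "1 < k" using \<open>even k\<close> \<open>0 < k\<close> by (cases "k = 1") auto
  then obtain l m where bezout: "n * l = m * k + 1" and "m \<le> n"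
    using \<open>coprime k n\<close> by (auto elim: bezout_bounded)
  have "odd (n * l)" using bezout \<open>even k\<close> by simp
  then have "odd l" by simp
  have odd_Int: "odd (card (cyclic_edge n k i \<inter> progression n k s m))" if "i < n" "i \<noteq> s" for i
    using card_cyclic_edge_Int_progression[OF bezout _ \<open>m \<le> n\<close> _ \<open>s < n\<close>] that assms \<open>odd l\<close> by simp
  have "progression n k s m \<subseteq> {..<n}" using \<open>k < n\<close> by (auto simp: progression_def)
  with odd_Int show ?thesis
    using \<open>0 < k\<close> unfolding odd_bipartite_def by (auto simp: edges_cyclic_hypergraph)
qed

theorem theorem4p8:
  fixes k n :: nat
  assumes "even k" and "k > 2" and "odd n" and "n > k"
  shows "minimal_non_odd_bipartite (cyclic_hypergraph n k) \<longleftrightarrow> gcd k n = 1"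
proof -
  have "0 < k" using \<open>k > 2\<close> by simp
  have "\<not> odd_bipartite (cyclic_hypergraph n k)"
    using assms \<open>0 < k\<close> by (intro not_odd_bipartite_cyclic_hypergraph)
  then have "minimal_non_odd_bipartite (cyclic_hypergraph n k) \<longleftrightarrow>
      (\<forall>s<n. odd_bipartite (delete_edge (cyclic_hypergraph n k) (cyclic_edge n k s)))"
    using \<open>0 < k\<close> by (auto simp: minimal_non_odd_bipartite_def edges_cyclic_hypergraph)
  also have "\<dots> \<longleftrightarrow> (\<forall>s<n. coprime k n)"
    using assms \<open>0 < k\<close> not_odd_bipartite_delete_cyclic_edge odd_bipartite_delete_cyclic_edge by blast
  also have "\<dots> \<longleftrightarrow> gcd k n = 1"
    using \<open>n > k\<close> by (auto simp: coprime_iff_gcd_eq_1)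
  finally show ?thesis .
qed

end
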